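(* Let $f:[0,\infty)\to\mathbb{R}$ be a continuous function with $f(0)\ge 0$, and let $\mu:[0,\infty)\to\mathbb{R}$ be a continuous monotone function such that $$\lambda(l)=\sup_{a<b<l}\frac{|\mu(b)-\mu(a)|}{b-a}<\infty\quad\text{for every } l,$$ and such that, if $\mu(l)\to-\infty$ as $l\to\infty$, then $$\sum_{n}(|\mu(n)|\vee 1)^{-1}=\infty .$$ Then there is a unique continuous function $L:[0,\infty)\to\mathbb{R}$ satisfying: 1. $x(t)=f(t)+L(t)+\int_0^t \mu(L(s))\,ds\ge 0$ for all $t\ge 0$; 2. $L(0)=0$ and $L$ is nondecreasing; 3. $L$ is flat off $\{t: x(t)=0\}$, i.e. $\int_0^\infty 1_{\{x(s)>0\}}\,dL(s)=0$.
   Context: Monotone means nondecreasing or nonincreasing. In the supremum defining $\lambda(l)$, $a,b$ range over the domain $[0,\infty)$ of $\mu$. $a\vee b=\max(a,b)$; the sum is over positive integers $n$. *)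

theory Defs
  imports "HOL-Analysis.Analysis"
begin

text \<open>
  Functions on the half-line are represented by functions \<^typ>\<open>real \<Rightarrow> real\<close> of which only the
  restriction to \<^term>\<open>{0::real..}\<close> is ever used.
\<close>

definition lambda_sup :: "(real \<Rightarrow> real) \<Rightarrow> real \<Rightarrow> ennreal" where
  "lambda_sup \<mu> l =
     (SUP (a, b) \<in> {(a, b). 0 \<le> a \<and> a < b \<and> b < l}. ennreal (\<bar>\<mu> b - \<mu> a\<bar> / (b - a)))"

definition reflected_path ::
    "(real \<Rightarrow> real) \<Rightarrow> (real \<Rightarrow> real) \<Rightarrow> (real \<Rightarrow> real) \<Rightarrow> real \<Rightarrow> real" where
  "reflected_path f \<mu> L t = f t + L t + integral {0..t} (\<lambda>s. \<mu> (L s))"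

text \<open>
  The Lebesgue--Stieltjes measure $dL$. The library's \<^const>\<open>interval_measure\<close> wants a nondecreasing
  right-continuous function on the whole line, so \<open>L\<close> is extended to the left of 0 by the constant
  \<open>L 0\<close>; for continuous nondecreasing \<open>L\<close> this puts no mass on the set of points \<open>\<le> 0\<close>.
  Without monotonicity of \<open>L\<close> the measure has no meaning.
\<close>

definition stieltjes_measure :: "(real \<Rightarrow> real) \<Rightarrow> real measure" where
  "stieltjes_measure L = interval_measure (\<lambda>t. L (max 0 t))"

definition reflection_solution ::
    "(real \<Rightarrow> real) \<Rightarrow> (real \<Rightarrow> real) \<Rightarrow> (real \<Rightarrow> real) \<Rightarrow> bool" where
  "reflection_solution f \<mu> L \<longleftrightarrow>
     continuous_on {0..} L \<and>
     (\<forall>t\<ge>0. reflected_path f \<mu> L t \<ge> 0) \<and>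
     L 0 = 0 \<and> mono_on {0..} L \<and>
     (\<integral>\<^sup>+s\<in>{0..}. indicator {s. reflected_path f \<mu> L s > 0} s \<partial>stieltjes_measure L) = 0"

end

theory Submission
  imports Defs
begin

text \<open>
  Given \<open>L\<close>, put \<open>g t = f t + \<integral>\<^sub>0\<^sup>t \<mu> (L s) ds\<close>. The three conditions on \<open>L\<close> say that it solves the Skorokhod
  reflection problem for \<open>g\<close>, and for a continuous \<open>g\<close> with \<open>g 0 \<ge> 0\<close> the only solution of that problem
  is the running supremum of \<open>max 0 (- g)\<close>, called \<open>regulator g\<close> here (\<open>regulator_unique\<close>,
  \<open>regulator_solves\<close>). The theorem is therefore about the fixed points of
  \<open>L \<mapsto> regulator (f + \<integral> \<mu> \<circ> L)\<close>.

  The running supremum is nonexpansive in the supremum norm, and \<open>\<lambda>(l) < \<infinity>\<close> makes \<open>\<mu>\<close> Lipschitz on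
  bounded sets. As for an ordinary differential equation, an exponential weight turns the map into a
  contraction (\<open>reflection_map_contraction\<close>) as long as the values of \<open>L\<close> stay in a bounded set. This
  gives uniqueness at once, and existence on every \<open>[0, T]\<close> if \<open>\<mu>\<close> is frozen beyond a high level.

  What remains is to rule out explosion, that is, to show that the solution on \<open>[0, T]\<close> does not reach the
  level at which \<open>\<mu>\<close> was frozen (\<open>fixed_point_bound\<close>). The path is dominated by a \<open>y\<close> with \<open>y' \<le> \<nu> y\<close>, where
  \<open>\<nu> \<ge> 1\<close> is a nondecreasing majorant of \<open>- \<mu>\<close>, and such a \<open>y\<close> takes infinite time to escape because
  \<open>\<integral> dl / \<nu> l\<close> diverges. It is for this divergence that the monotonicity of \<open>\<mu>\<close> and the
  condition on the series are used (\<open>nonexplosive_majorant\<close>).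
\<close>

section \<open>The running supremum\<close>

lemma continuous_on_half_lineI:
  fixes h :: "real \<Rightarrow> 'a::topological_space"
  assumes "\<And>T. 0 \<le> T \<Longrightarrow> continuous_on {0..T} h"
  shows "continuous_on {0..} h"
  unfolding continuous_on_eq_continuous_within
proof
  fix t :: real assume t: "t \<in> {0..}"
  have "continuous (at t within {0..t+1}) h"
    using assms[of "t+1"] t by (simp add: continuous_on_eq_continuous_within)
  moreover have "at t within {0..} = at t within {0..t+1}"
    by (rule at_within_nhd[of _ "{..<t+1}"]) auto
  ultimately show "continuous (at t within {0..}) h" by simp
qed

text \<open>
  Skorokhod's formula: the least nondecreasing \<open>L \<ge> 0\<close> that keeps \<open>g + L\<close> nonnegative. Where \<open>g\<close> is
  unbounded below the supremum is a junk value, so continuity is assumed throughout.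
\<close>

definition regulator :: "(real \<Rightarrow> real) \<Rightarrow> real \<Rightarrow> real" where
  "regulator g t = (SUP s\<in>{0..t}. max 0 (- g s))"

lemma regulator_cong:
  assumes "\<And>s. 0 \<le> s \<Longrightarrow> s \<le> t \<Longrightarrow> g s = h s"
  shows "regulator g t = regulator h t"
  unfolding regulator_def using assms by (intro SUP_cong) auto

lemma regulator_upper:
  assumes "continuous_on {0..t} g" "0 \<le> s" "s \<le> t"
  shows "max 0 (- g s) \<le> regulator g t"
  unfolding regulator_def
proof (rule cSUP_upper)
  have "compact ((\<lambda>s. max 0 (- g s)) ` {0..t})"
    by (intro compact_continuous_image continuous_intros assms) auto
  then show "bdd_above ((\<lambda>s. max 0 (- g s)) ` {0..t})"
    by (intro bounded_imp_bdd_above compact_imp_bounded)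
qed (use assms in auto)

lemma regulator_nonneg:
  assumes "continuous_on {0..t} g" "0 \<le> t"
  shows "0 \<le> regulator g t"
  using regulator_upper[OF assms(1), of 0] assms(2) by simp

lemma regulator_least:
  assumes "0 \<le> t" "0 \<le> c" "\<And>s. 0 \<le> s \<Longrightarrow> s \<le> t \<Longrightarrow> - g s \<le> c"
  shows "regulator g t \<le> c"
  unfolding regulator_def using assms by (intro cSUP_least) auto

lemma regulator_mono:
  assumes "continuous_on {0..t} g" "0 \<le> s" "s \<le> t"
  shows "regulator g s \<le> regulator g t"
proof (rule regulator_least)
  show "- g r \<le> regulator g t" if "0 \<le> r" "r \<le> s" for r
    using regulator_upper[OF assms(1), of r] that assms by simp
qed (use assms regulator_nonneg[OF assms(1)] in auto)

lemma regulator_nonexpansive: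
  assumes "continuous_on {0..t} g" "continuous_on {0..t} h" "0 \<le> t"
    and d: "\<And>s. 0 \<le> s \<Longrightarrow> s \<le> t \<Longrightarrow> \<bar>g s - h s\<bar> \<le> d"
  shows "\<bar>regulator g t - regulator h t\<bar> \<le> d"
proof -
  have *: "regulator g t \<le> regulator h t + d"
    if "continuous_on {0..t} h" and "\<And>s. 0 \<le> s \<Longrightarrow> s \<le> t \<Longrightarrow> \<bar>g s - h s\<bar> \<le> d" for g h
  proof (rule regulator_least)
    show "0 \<le> regulator h t + d"
      using regulator_nonneg[OF that(1)] that(2)[of 0] assms(3) by auto
    show "- g s \<le> regulator h t + d" if s: "0 \<le> s" "s \<le> t" for s
      using regulator_upper[OF \<open>continuous_on {0..t} h\<close> s]
        \<open>\<And>s. 0 \<le> s \<Longrightarrow> s \<le> t \<Longrightarrow> \<bar>g s - h s\<bar> \<le> d\<close>[OF s] by linarith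
  qed (use assms in auto)
  have "\<bar>h s - g s\<bar> \<le> d" if "0 \<le> s" "s \<le> t" for s using d[OF that] by linarith
  with *[OF assms(2) d] *[OF assms(1), of h] show ?thesis by fastforce
qed

text \<open>
  Over \<open>[s, t]\<close> the running supremum grows by at most the oscillation of \<open>g\<close> there, so it inherits the
  modulus of continuity of \<open>g\<close>.
\<close>

lemma continuous_on_regulator:
  assumes g: "continuous_on {0..T} g"
  shows "continuous_on {0..T} (regulator g)"
proof -
  have "uniformly_continuous_on {0..T} g"
    using g by (intro compact_uniformly_continuous) auto
  have step: "regulator g t \<le> regulator g s + e"
    if "0 \<le> s" "s \<le> t" "t \<le> T" "0 \<le> e"
      and near: "\<And>r. s \<le> r \<Longrightarrow> r \<le> t \<Longrightarrow> \<bar>g r - g s\<bar> \<le> e" for s t e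
  proof (rule regulator_least)
    have gs: "continuous_on {0..s} g" by (rule continuous_on_subset[OF g]) (use that in auto)
    show "0 \<le> regulator g s + e" using regulator_nonneg[OF gs] that by simp
    show "- g r \<le> regulator g s + e" if "0 \<le> r" "r \<le> t" for r
    proof (cases "r \<le> s")
      case True
      then show ?thesis using regulator_upper[OF gs, of r] that \<open>0 \<le> e\<close> by linarith
    next
      case False
      then show ?thesis
        using regulator_upper[OF gs, of s] near[of r] that \<open>0 \<le> s\<close> by linarith
    qed
  qed (use that in auto)
  have "\<exists>d>0. \<forall>t\<in>{0..T}. dist t s < d \<longrightarrow> dist (regulator g t) (regulator g s) < e"
    if s: "s \<in> {0..T}" and e: "e > 0" for s e
  proof -
    from \<open>uniformly_continuous_on {0..T} g\<close> e obtain d where d: "d > 0"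
      and *: "\<And>u v. u \<in> {0..T} \<Longrightarrow> v \<in> {0..T} \<Longrightarrow> dist u v < d \<Longrightarrow> dist (g u) (g v) < e/2"
      unfolding uniformly_continuous_on_def by (metis half_gt_zero)
    have ord: "\<bar>regulator g v - regulator g u\<bar> < e"
      if "u \<in> {0..T}" "v \<in> {0..T}" "u \<le> v" "v - u < d" for u v
    proof -
      have "regulator g v \<le> regulator g u + e/2"
      proof (rule step)
        show "\<bar>g r - g u\<bar> \<le> e/2" if "u \<le> r" "r \<le> v" for r
          using *[of r u] that \<open>u \<in> {0..T}\<close> \<open>v \<in> {0..T}\<close> \<open>v - u < d\<close> by (auto simp: dist_real_def)
      qed (use that e in auto)
      moreover have "regulator g u \<le> regulator g v"
        by (rule regulator_mono) (use that continuous_on_subset[OF g] in auto)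
      ultimately show ?thesis using e by auto
    qed
    have "dist (regulator g t) (regulator g s) < e" if "t \<in> {0..T}" "dist t s < d" for t
      using ord[of t s] ord[of s t] that s by (cases "t \<le> s") (auto simp: dist_real_def abs_minus_commute)
    then show ?thesis using d by blast
  qed
  then show ?thesis unfolding continuous_on_iff by blast
qed

section \<open>Flatness with respect to the Stieltjes measure\<close>

lemma emeasure_stieltjes_Ioc:
  assumes "continuous_on {0..} L" "mono_on {0..} L" "a \<le> b"
  shows "emeasure (stieltjes_measure L) {a<..b} = ennreal (L (max 0 b) - L (max 0 a))"
proof -
  have "continuous_on UNIV (\<lambda>t. L (max 0 t))"
    by (rule continuous_on_compose2[OF assms(1)]) (auto intro!: continuous_intros)
  then have "continuous (at_right t) (\<lambda>t. L (max 0 t))" for t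
    by (meson UNIV_I continuous_on_eq_continuous_within continuous_within_subset subset_UNIV)
  moreover have "L (max 0 x) \<le> L (max 0 y)" if "x \<le> y" for x y
    using assms(2) that by (auto simp: mono_on_def)
  ultimately show ?thesis
    unfolding stieltjes_measure_def using assms(3) by (intro emeasure_interval_measure_Ioc) auto
qed

text \<open>
  As \<open>A\<close> is arbitrary and perhaps not measurable, the argument compares integrands rather than
  measures of sets.
\<close>

lemma const_on_gap_of_null_integral:
  assumes L: "continuous_on {0..} L" "mono_on {0..} L"
    and null: "(\<integral>\<^sup>+s\<in>{0..}. indicator A s \<partial>stieltjes_measure L) = 0"
    and "0 \<le> a" "a \<le> b" "{a<..b} \<subseteq> A"
  shows "L a = L b"
proof -
  have "emeasure (stieltjes_measure L) {a<..b} = (\<integral>\<^sup>+s. indicator {a<..b} s \<partial>stieltjes_measure L)"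
    by (simp add: stieltjes_measure_def)
  also have "\<dots> \<le> (\<integral>\<^sup>+s\<in>{0..}. indicator A s \<partial>stieltjes_measure L)"
    using assms by (intro nn_integral_mono) (auto split: split_indicator)
  finally have "ennreal (L b - L a) \<le> 0"
    using emeasure_stieltjes_Ioc[OF L \<open>a \<le> b\<close>] assms by simp
  moreover have "L a \<le> L b" using L(2) assms by (auto simp: mono_on_def)
  ultimately show ?thesis by simp
qed

text \<open>
  By the Lindelof property: around each point of \<open>A\<close> there is an interval with rational endpoints on
  which \<open>L\<close> is constant. Each such interval is null, and there are countably many. The truncation
  \<open>max 0\<close> takes care of the endpoint \<open>0\<close>, whose neighbourhoods stick out of the half-line.
\<close>

lemma null_integral_of_locally_const:
  assumes L: "continuous_on {0..} L" "mono_on {0..} L"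
    and loc: "\<And>s. 0 \<le> s \<Longrightarrow> s \<in> A \<Longrightarrow> \<exists>d>0. L (max 0 (s - d)) = L (s + d)"
  shows "(\<integral>\<^sup>+s\<in>{0..}. indicator A s \<partial>stieltjes_measure L) = 0"
proof -
  define I where "I = {(p, q). p \<in> \<rat> \<and> q \<in> \<rat> \<and> p \<le> q \<and> L (max 0 p) = L (max 0 q)}"
  define N where "N = (\<Union>(p, q)\<in>I. {p<..q})"
  have "I \<subseteq> \<rat> \<times> \<rat>" unfolding I_def by auto
  then have "countable I" by (rule countable_subset) (intro countable_SIGMA countable_rat)
  then have "N \<in> null_sets (stieltjes_measure L)"
    unfolding N_def
  proof (rule null_sets_UN')
    fix pq assume "pq \<in> I"
    then show "(case pq of (p, q) \<Rightarrow> {p<..q}) \<in> null_sets (stieltjes_measure L)"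
      using emeasure_stieltjes_Ioc[OF L] unfolding I_def
      by (auto simp: stieltjes_measure_def intro!: null_setsI)
  qed
  have "A \<inter> {0..} \<subseteq> N"
  proof
    fix s assume "s \<in> A \<inter> {0..}"
    then obtain d where d: "d > 0" "L (max 0 (s - d)) = L (s + d)" and s: "s \<in> A" "0 \<le> s"
      using loc[of s] by auto
    obtain p where p: "p \<in> \<rat>" "s - d < p" "p < s" using Rats_dense_in_real[of "s - d" s] d by auto
    obtain q where q: "q \<in> \<rat>" "s < q" "q < s + d" using Rats_dense_in_real[of s "s + d"] d by auto
    have mono': "L (max 0 u) \<le> L (max 0 v)" if "u \<le> v" for u v
      using L(2) that by (auto simp: mono_on_def)
    have "L (max 0 p) = L (max 0 q)"
      using mono'[of "s - d" p] mono'[of p q] mono'[of q "s + d"] p q s d by auto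
    then have "(p, q) \<in> I" using p q d unfolding I_def by auto
    then show "s \<in> N" using p q unfolding N_def by (auto intro!: bexI[of _ "(p, q)"])
  qed
  have "(\<integral>\<^sup>+s\<in>{0..}. indicator A s \<partial>stieltjes_measure L) \<le> (\<integral>\<^sup>+s. indicator N s \<partial>stieltjes_measure L)"
    using \<open>A \<inter> {0..} \<subseteq> N\<close> by (intro nn_integral_mono) (auto split: split_indicator)
  also have "\<dots> = 0" using \<open>N \<in> null_sets _\<close> by (simp add: null_sets_def)
  finally show ?thesis by simp
qed

section \<open>The Skorokhod problem\<close>

text \<open>
  A path \<open>L\<close> that pushes only at zeros of \<open>g + L\<close> cannot exceed the least admissible one: if \<open>L\<close> were above
  \<open>c = regulator g t\<close> at time \<open>t\<close>, then after the last time at which \<open>L \<le> c\<close> the path \<open>g + L\<close> would be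
  positive, so \<open>L\<close> would have stayed constant and could not have got above \<open>c\<close>.
\<close>

lemma regulator_unique:
  assumes g: "continuous_on {0..} g"
    and L: "continuous_on {0..} L" "mono_on {0..} L" "L 0 = 0"
    and pos: "\<And>t. 0 \<le> t \<Longrightarrow> 0 \<le> g t + L t"
    and null: "(\<integral>\<^sup>+s\<in>{0..}. indicator {s. 0 < g s + L s} s \<partial>stieltjes_measure L) = 0"
    and t: "0 \<le> t"
  shows "L t = regulator g t"
proof (rule antisym)
  have gt: "continuous_on {0..t} g" and Lt: "continuous_on {0..t} L"
    using g L by (auto intro: continuous_on_subset)
  have Lmono: "L r \<le> L s" if "0 \<le> r" "r \<le> s" for r s
    using L(2) that by (auto simp: mono_on_def)
  show "regulator g t \<le> L t"
  proof (rule regulator_least)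
    show "- g s \<le> L t" if "0 \<le> s" "s \<le> t" for s using pos[of s] Lmono[of s t] that by linarith
  qed (use t Lmono[of 0 t] L in auto)
  define c where "c = regulator g t"
  have c: "0 \<le> c" "\<And>s. 0 \<le> s \<Longrightarrow> s \<le> t \<Longrightarrow> - g s \<le> c"
    unfolding c_def using regulator_nonneg[OF gt t] regulator_upper[OF gt] by auto
  define C where "C = {0..t} \<inter> L -` {..c}"
  have "closed C" unfolding C_def by (intro continuous_closed_preimage Lt) auto
  moreover have "C \<noteq> {}" using L(3) c t by (auto simp: C_def)
  moreover have bdd: "bdd_above C" by (auto simp: C_def intro: bdd_above.I2)
  ultimately have r: "Sup C \<in> C" by (metis closed_contains_Sup)
  have "{Sup C<..t} \<subseteq> {s. 0 < g s + L s}"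
  proof
    fix s assume s: "s \<in> {Sup C<..t}"
    then have "s \<notin> C" using bdd cSup_upper[of s C] by auto
    then have "L s > c" "0 \<le> s" "s \<le> t" using s r by (auto simp: C_def)
    then show "s \<in> {s. 0 < g s + L s}" using c(2)[of s] by simp
  qed
  then have "L (Sup C) = L t"
    using r by (intro const_on_gap_of_null_integral[OF L(1,2) null]) (auto simp: C_def)
  then show "L t \<le> regulator g t" using r by (simp add: C_def c_def)
qed

text \<open>
  Flatness holds because \<open>g s + L s > 0\<close> says that the running supremum at time \<open>s\<close> strictly exceeds the
  current value \<open>- g s\<close>; by continuity it does so with a margin near \<open>s\<close>, where no new supremum is
  therefore attained and \<open>L\<close> is constant.
\<close>

lemma regulator_solves:
  assumes g: "continuous_on {0..} g" and "0 \<le> g 0"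
    and L: "continuous_on {0..} L" and eq: "\<And>t. 0 \<le> t \<Longrightarrow> L t = regulator g t"
  shows "L 0 = 0" "mono_on {0..} L" "\<And>t. 0 \<le> t \<Longrightarrow> 0 \<le> g t + L t"
    and "(\<integral>\<^sup>+s\<in>{0..}. indicator {s. 0 < g s + L s} s \<partial>stieltjes_measure L) = 0"
proof -
  have gt: "continuous_on {0..t} g" for t using g by (auto intro: continuous_on_subset)
  show "L 0 = 0" using eq[of 0] \<open>0 \<le> g 0\<close> by (simp add: regulator_def)
  show mono: "mono_on {0..} L"
    using regulator_mono[OF gt] eq by (auto simp: mono_on_def)
  show "0 \<le> g t + L t" if "0 \<le> t" for t
    using regulator_upper[OF gt, of t t] eq[of t] that by simp
  show "(\<integral>\<^sup>+s\<in>{0..}. indicator {s. 0 < g s + L s} s \<partial>stieltjes_measure L) = 0"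
  proof (rule null_integral_of_locally_const[OF L mono])
    fix s assume s: "0 \<le> s" "s \<in> {s. 0 < g s + L s}"
    define e where "e = (g s + L s) / 2"
    have "e > 0" using s by (simp add: e_def)
    then obtain d where d: "d > 0"
      and near: "\<And>r. 0 \<le> r \<Longrightarrow> dist r s < d \<Longrightarrow> dist (g r) (g s) < e"
      using g s unfolding continuous_on_iff by (metis atLeast_iff)
    define a where "a = max 0 (s - d/2)"
    define b where "b = s + d/2"
    have ab: "0 \<le> a" "a \<le> s" "s \<le> b" "a \<le> b" using d s by (auto simp: a_def b_def)
    have low: "- g r \<le> L s - e" if "a \<le> r" "r \<le> b" for r
    proof -
      have "dist r s < d" "0 \<le> r" using that d unfolding a_def b_def dist_real_def by auto
      from near[OF this(2,1)] have "\<bar>g r - g s\<bar> < e" by (simp add: dist_real_def)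
      moreover have "2 * e = g s + L s" by (simp add: e_def)
      ultimately show ?thesis by linarith
    qed
    have up: "regulator g u \<le> max (L a) (L s - e)" if "a \<le> u" "u \<le> b" for u
    proof (rule regulator_least)
      have "0 \<le> L a" using regulator_nonneg[OF gt] eq ab by simp
      then show "0 \<le> max (L a) (L s - e)" by simp
      show "- g r \<le> max (L a) (L s - e)" if "0 \<le> r" "r \<le> u" for r
        using regulator_upper[OF gt, of r a] low[of r] that \<open>u \<le> b\<close> eq[of a] ab
        by (cases "r \<le> a") auto
    qed (use that ab in auto)
    have "L s \<le> L a" using up[of s] eq[of s] s ab \<open>e > 0\<close> by auto
    moreover have "L b \<le> max (L a) (L s - e)" using up[of b] eq[of b] ab s by auto
    moreover have "L a \<le> L b" using mono ab by (auto simp: mono_on_def)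
    ultimately have "L a = L b" using \<open>e > 0\<close> by auto
    then show "\<exists>d>0. L (max 0 (s - d)) = L (s + d)"
      using d by (intro exI[of _ "d/2"]) (auto simp: a_def b_def)
  qed
qed

section \<open>Solutions as fixed points\<close>

definition reflection_map :: "(real \<Rightarrow> real) \<Rightarrow> (real \<Rightarrow> real) \<Rightarrow> (real \<Rightarrow> real) \<Rightarrow> real \<Rightarrow> real" where
  "reflection_map f \<mu> L = regulator (\<lambda>t. f t + integral {0..t} (\<lambda>s. \<mu> (L s)))"

lemma reflection_map_cong:
  assumes "\<And>s. 0 \<le> s \<Longrightarrow> s \<le> t \<Longrightarrow> \<mu> (L s) = \<nu> (M s)"
  shows "reflection_map f \<mu> L t = reflection_map f \<nu> M t"
  unfolding reflection_map_def
proof (rule regulator_cong)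
  show "f s + integral {0..s} (\<lambda>r. \<mu> (L r)) = f s + integral {0..s} (\<lambda>r. \<nu> (M r))"
    if "0 \<le> s" "s \<le> t" for s
    using assms that by (auto intro!: integral_cong)
qed

text \<open>
  Nonnegativity of \<open>L\<close> is part of the notion because \<open>\<mu>\<close> is continuous and Lipschitz only on the half-line,
  and the continuity of the integrand \<open>\<mu> \<circ> L\<close>, hence the meaning of the supremum, depends on it.
\<close>

definition solves_up_to :: "(real \<Rightarrow> real) \<Rightarrow> (real \<Rightarrow> real) \<Rightarrow> real \<Rightarrow> (real \<Rightarrow> real) \<Rightarrow> bool" where
  "solves_up_to f \<mu> T L \<longleftrightarrow> continuous_on {0..T} L \<and>
     (\<forall>t. 0 \<le> t \<longrightarrow> t \<le> T \<longrightarrow> 0 \<le> L t \<and> L t = reflection_map f \<mu> L t)"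

lemma solves_up_toD:
  assumes "solves_up_to f \<mu> T L"
  shows "continuous_on {0..T} L" "\<And>t. 0 \<le> t \<Longrightarrow> t \<le> T \<Longrightarrow> 0 \<le> L t"
    "\<And>t. 0 \<le> t \<Longrightarrow> t \<le> T \<Longrightarrow> L t = reflection_map f \<mu> L t"
  using assms unfolding solves_up_to_def by blast+

lemma solves_up_to_mono:
  assumes "solves_up_to f \<mu> T L" "S \<le> T"
  shows "solves_up_to f \<mu> S L"
proof -
  have "continuous_on {0..S} L"
    by (rule continuous_on_subset[OF solves_up_toD(1)[OF assms(1)]]) (use assms(2) in auto)
  then show ?thesis
    unfolding solves_up_to_def using solves_up_toD(2,3)[OF assms(1)] order_trans[OF _ assms(2)]
    by blast
qed

lemma solves_up_to_cong:
  assumes "solves_up_to f \<mu> T L" and eq: "\<And>t. 0 \<le> t \<Longrightarrow> t \<le> T \<Longrightarrow> M t = L t"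
  shows "solves_up_to f \<mu> T M"
  unfolding solves_up_to_def
proof (intro conjI allI impI)
  note L = solves_up_toD[OF assms(1)]
  show "continuous_on {0..T} M"
    using L(1) eq by (subst continuous_on_cong[OF refl, of _ _ L]) auto
  fix t assume t: "0 \<le> t" "t \<le> T"
  show "0 \<le> M t" using L(2)[OF t] eq[OF t] by simp
  have "M t = reflection_map f \<mu> L t" using L(3)[OF t] eq[OF t] by (rule trans[rotated])
  also have "\<dots> = reflection_map f \<mu> M t"
    by (rule reflection_map_cong) (use eq t in auto)
  finally show "M t = reflection_map f \<mu> M t" .
qed

lemma continuous_on_drifted_path:
  fixes f \<mu> L :: "real \<Rightarrow> real"
  assumes "continuous_on {0..T} f" "continuous_on B \<mu>" "continuous_on {0..T} L"
    and "\<And>t. 0 \<le> t \<Longrightarrow> t \<le> T \<Longrightarrow> L t \<in> B"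
  shows "continuous_on {0..T} (\<lambda>t. f t + integral {0..t} (\<lambda>s. \<mu> (L s)))"
proof -
  have "continuous_on {0..T} (\<lambda>s. \<mu> (L s))"
    by (rule continuous_on_compose2[OF assms(2,3)]) (use assms(4) in auto)
  then show ?thesis
    by (intro continuous_on_add assms(1) indefinite_integral_continuous_1 integrable_continuous_real)
qed

lemma continuous_on_drifted_path_half_line:
  fixes f \<mu> L :: "real \<Rightarrow> real"
  assumes "continuous_on {0..} f" "continuous_on {0..} \<mu>" "continuous_on {0..} L"
    and "\<And>t. 0 \<le> t \<Longrightarrow> 0 \<le> L t"
  shows "continuous_on {0..} (\<lambda>t. f t + integral {0..t} (\<lambda>s. \<mu> (L s)))"
proof (rule continuous_on_half_lineI)
  show "continuous_on {0..T} (\<lambda>t. f t + integral {0..t} (\<lambda>s. \<mu> (L s)))" for T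
    by (rule continuous_on_drifted_path[OF _ assms(2)])
       (use assms in \<open>auto intro: continuous_on_subset\<close>)
qed

lemma reflection_solution_imp_fixed_point:
  assumes f: "continuous_on {0..} f" and \<mu>: "continuous_on {0..} \<mu>"
    and sol: "reflection_solution f \<mu> L"
  shows "continuous_on {0..} L" "\<And>t. 0 \<le> t \<Longrightarrow> 0 \<le> L t"
    "\<And>t. 0 \<le> t \<Longrightarrow> L t = reflection_map f \<mu> L t"
proof -
  note S = sol[unfolded reflection_solution_def]
  show L: "continuous_on {0..} L" using S by simp
  show nonneg: "0 \<le> L t" if "0 \<le> t" for t
    using S that mono_onD[of "{0..}" L 0 t] by auto
  define g where "g = (\<lambda>t. f t + integral {0..t} (\<lambda>s. \<mu> (L s)))"
  have "continuous_on {0..} g" unfolding g_def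
    by (rule continuous_on_drifted_path_half_line[OF f \<mu> L nonneg])
  moreover have "reflected_path f \<mu> L = (\<lambda>t. g t + L t)"
    unfolding g_def reflected_path_def by auto
  ultimately show "L t = reflection_map f \<mu> L t" if "0 \<le> t" for t
    unfolding reflection_map_def g_def[symmetric] using S that
    by (intro regulator_unique) auto
qed

lemma fixed_point_imp_reflection_solution:
  assumes f: "continuous_on {0..} f" "0 \<le> f 0" and \<mu>: "continuous_on {0..} \<mu>"
    and L: "continuous_on {0..} L" "\<And>t. 0 \<le> t \<Longrightarrow> 0 \<le> L t"
    and eq: "\<And>t. 0 \<le> t \<Longrightarrow> L t = reflection_map f \<mu> L t"
  shows "reflection_solution f \<mu> L"
proof -
  define g where "g = (\<lambda>t. f t + integral {0..t} (\<lambda>s. \<mu> (L s)))"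
  have "continuous_on {0..} g" unfolding g_def
    by (rule continuous_on_drifted_path_half_line[OF f(1) \<mu> L])
  moreover have "0 \<le> g 0" using f by (simp add: g_def)
  moreover have "L t = regulator g t" if "0 \<le> t" for t
    using eq[OF that] by (simp add: reflection_map_def g_def)
  moreover have "reflected_path f \<mu> L = (\<lambda>t. g t + L t)"
    unfolding g_def reflected_path_def by auto
  ultimately show ?thesis
    using regulator_solves[of g L] L(1) by (simp add: reflection_solution_def)
qed

section \<open>Contraction in a weighted norm\<close>

text \<open>
  While the values stay in a set on which \<open>\<mu>\<close> is \<open>\<Lambda>\<close>-Lipschitz, in the norm \<open>sup exp (- 2 \<Lambda> t) \<bar>L t\<bar>\<close> the map is a contraction with factor \<open>1/2\<close> on every bounded time interval,
  however long: the running supremum does not expand distances, and \<open>\<Lambda>\<close> times the integral of \<open>exp (2 \<Lambda> s)\<close> over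
  \<open>[0, t]\<close> is at most \<open>exp (2 \<Lambda> t) / 2\<close>.
\<close>

lemma reflection_map_contraction:
  fixes f \<mu> L M :: "real \<Rightarrow> real"
  assumes f: "continuous_on {0..T} f"
    and \<mu>: "\<Lambda>-lipschitz_on B \<mu>" and \<Lambda>: "0 < \<Lambda>"
    and L: "continuous_on {0..T} L" "\<And>t. 0 \<le> t \<Longrightarrow> t \<le> T \<Longrightarrow> L t \<in> B"
    and M: "continuous_on {0..T} M" "\<And>t. 0 \<le> t \<Longrightarrow> t \<le> T \<Longrightarrow> M t \<in> B"
    and close: "\<And>s. 0 \<le> s \<Longrightarrow> s \<le> T \<Longrightarrow> \<bar>L s - M s\<bar> \<le> d * exp (2 * \<Lambda> * s)"
    and t: "0 \<le> t" "t \<le> T"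
  shows "\<bar>reflection_map f \<mu> L t - reflection_map f \<mu> M t\<bar> \<le> d / 2 * exp (2 * \<Lambda> * t)"
  unfolding reflection_map_def
proof (rule regulator_nonexpansive)
  note \<mu>c = lipschitz_on_continuous_on[OF \<mu>]
  have cont: "continuous_on {0..T} (\<lambda>t. f t + integral {0..t} (\<lambda>s. \<mu> (L s)))"
    "continuous_on {0..T} (\<lambda>t. f t + integral {0..t} (\<lambda>s. \<mu> (M s)))"
    using continuous_on_drifted_path[OF f \<mu>c] L M by auto
  show "continuous_on {0..t} (\<lambda>t. f t + integral {0..t} (\<lambda>s. \<mu> (L s)))"
    "continuous_on {0..t} (\<lambda>t. f t + integral {0..t} (\<lambda>s. \<mu> (M s)))"
    using cont t by (auto intro: continuous_on_subset)
  have "0 \<le> d" using close[of 0] t by auto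
  show "\<bar>f s + integral {0..s} (\<lambda>r. \<mu> (L r)) - (f s + integral {0..s} (\<lambda>r. \<mu> (M r)))\<bar>
      \<le> d / 2 * exp (2 * \<Lambda> * t)" if s: "0 \<le> s" "s \<le> t" for s
  proof -
    have "continuous_on {0..s} (\<lambda>r. \<mu> (L r))" "continuous_on {0..s} (\<lambda>r. \<mu> (M r))"
      using L M s t by (auto intro!: continuous_on_compose2[OF \<mu>c] intro: continuous_on_subset)
    note int = this[THEN integrable_continuous_real]
    have exp_int: "((\<lambda>r. \<Lambda> * (d * exp (2 * \<Lambda> * r))) has_integral
        d / 2 * exp (2 * \<Lambda> * s) - d / 2 * exp (2 * \<Lambda> * 0)) {0..s}"
      using s \<Lambda>
      by (intro fundamental_theorem_of_calculus)
         (auto intro!: derivative_eq_intros simp flip: has_real_derivative_iff_has_vector_derivative)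
    have "\<bar>integral {0..s} (\<lambda>r. \<mu> (L r)) - integral {0..s} (\<lambda>r. \<mu> (M r))\<bar>
        = norm (integral {0..s} (\<lambda>r. \<mu> (L r) - \<mu> (M r)))"
      using int by (simp add: integral_diff)
    also have "\<dots> \<le> integral {0..s} (\<lambda>r. \<Lambda> * (d * exp (2 * \<Lambda> * r)))"
    proof (rule integral_norm_bound_integral)
      show "norm (\<mu> (L r) - \<mu> (M r)) \<le> \<Lambda> * (d * exp (2 * \<Lambda> * r))" if "r \<in> {0..s}" for r
      proof -
        have "norm (\<mu> (L r) - \<mu> (M r)) \<le> \<Lambda> * \<bar>L r - M r\<bar>"
          using lipschitz_onD[OF \<mu>, of "L r" "M r"] L(2)[of r] M(2)[of r] that s t
          by (simp add: dist_real_def)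
        also have "\<dots> \<le> \<Lambda> * (d * exp (2 * \<Lambda> * r))"
          using close[of r] that s t \<Lambda> by (intro mult_left_mono) auto
        finally show ?thesis .
      qed
    qed (use int exp_int in \<open>auto intro: integrable_diff\<close>)
    also have "\<dots> = d / 2 * exp (2 * \<Lambda> * s) - d / 2 * exp (2 * \<Lambda> * 0)"
      using exp_int by (rule integral_unique)
    also have "\<dots> \<le> d / 2 * exp (2 * \<Lambda> * s)" using \<open>0 \<le> d\<close> by simp
    also have "\<dots> \<le> d / 2 * exp (2 * \<Lambda> * t)"
      using \<open>0 \<le> d\<close> s \<Lambda> by (intro mult_left_mono) auto
    finally show ?thesis by simp
  qed
qed (use t in auto)

lemma reflection_map_fixed_point_unique:
  fixes f \<mu> L M :: "real \<Rightarrow> real"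
  assumes f: "continuous_on {0..T} f"
    and \<mu>: "\<Lambda>-lipschitz_on B \<mu>" and \<Lambda>: "0 < \<Lambda>"
    and solves: "solves_up_to f \<mu> T L" "solves_up_to f \<mu> T M"
    and range: "\<And>t. 0 \<le> t \<Longrightarrow> t \<le> T \<Longrightarrow> L t \<in> B" "\<And>t. 0 \<le> t \<Longrightarrow> t \<le> T \<Longrightarrow> M t \<in> B"
    and t: "0 \<le> t" "t \<le> T"
  shows "L t = M t"
proof -
  note L = solves_up_toD[OF solves(1)] and M = solves_up_toD[OF solves(2)]
  define w where "w = (\<lambda>s. \<bar>L s - M s\<bar> * exp (- (2 * \<Lambda> * s)))"
  have "continuous_on {0..T} w"
    unfolding w_def by (intro continuous_intros L M)
  \<comment> \<open>At a maximum point \<open>r\<close> of the weighted distance, contraction gives \<open>w r \<le> w r / 2\<close>.\<close>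
  then obtain r where r: "r \<in> {0..T}" and max: "\<And>s. s \<in> {0..T} \<Longrightarrow> w s \<le> w r"
    using continuous_attains_sup[of "{0..T}" w] t by auto
  have w: "\<bar>L s - M s\<bar> = w s * exp (2 * \<Lambda> * s)" for s
    by (simp add: w_def mult.assoc flip: exp_add)
  have "\<bar>reflection_map f \<mu> L r - reflection_map f \<mu> M r\<bar> \<le> w r / 2 * exp (2 * \<Lambda> * r)"
  proof (rule reflection_map_contraction[OF f \<mu> \<Lambda> L(1) range(1) M(1) range(2)])
    show "\<bar>L s - M s\<bar> \<le> w r * exp (2 * \<Lambda> * s)" if "0 \<le> s" "s \<le> T" for s
      unfolding w using max[of s] that by (intro mult_right_mono) auto
  qed (use r in auto)
  then have "w r * exp (2 * \<Lambda> * r) \<le> w r / 2 * exp (2 * \<Lambda> * r)"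
    using L(3)[of r] M(3)[of r] r w[of r] by simp
  then have "w r * exp (2 * \<Lambda> * r) \<le> 0" by simp
  then have "w r \<le> 0" by (simp add: mult_le_0_iff)
  then have "w t \<le> 0" using max[of t] t by simp
  then show ?thesis by (simp add: w_def mult_le_0_iff)
qed

text \<open>
  Banach's fixed point theorem, with the weight moved into the unknown: \<open>u\<close> stands for
  \<open>exp (- 2 \<Lambda> t) L t\<close>, so that the contraction is one for the plain supremum norm.
\<close>

lemma reflection_map_fixed_point_exists:
  fixes f \<mu> :: "real \<Rightarrow> real"
  assumes f: "continuous_on {0..T} f" and T: "0 \<le> T"
    and \<mu>: "\<Lambda>-lipschitz_on {0..} \<mu>" and \<Lambda>: "0 < \<Lambda>"
  shows "\<exists>L. solves_up_to f \<mu> T L"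
proof -
  \<comment> \<open>\<open>W u\<close> undoes the weight. Its truncation at 0 keeps the argument of \<open>\<mu>\<close> in the half-line; it is
    inactive at a fixed point because \<open>reflection_map\<close> is nonnegative. The clamp of \<open>t\<close> to \<open>[0, T]\<close> in
    \<open>A\<close> turns functions on the interval into bounded continuous functions on the line.\<close>
  define W :: "(real \<Rightarrow>\<^sub>C real) \<Rightarrow> real \<Rightarrow> real"
    where "W u = (\<lambda>t. max 0 (exp (2 * \<Lambda> * t) * apply_bcontfun u t))" for u
  define h where "h u = (\<lambda>t. exp (- (2 * \<Lambda> * t)) * reflection_map f \<mu> (W u) t)" for u
  define A where "A u = Bcontfun (\<lambda>t. h u (max 0 (min t T)))" for u
  have W: "continuous_on S (W u)" "0 \<le> W u t" for u t S
    unfolding W_def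
    by (auto intro!: continuous_intros continuous_on_subset[OF continuous_on_apply_bcontfun])
  have drift: "continuous_on {0..T} (\<lambda>t. f t + integral {0..t} (\<lambda>s. \<mu> (W u s)))" for u
    by (rule continuous_on_drifted_path[OF f lipschitz_on_continuous_on[OF \<mu>]]) (auto simp: W)
  have h: "continuous_on {0..T} (h u)" for u
    unfolding h_def reflection_map_def
    by (intro continuous_intros continuous_on_regulator drift)
  have "(\<lambda>t. h u (max 0 (min t T))) \<in> bcontfun" for u
    unfolding bcontfun_def mem_Collect_eq
  proof
    show "continuous_on UNIV (\<lambda>t. h u (max 0 (min t T)))"
      by (rule continuous_on_compose2[OF h]) (auto intro!: continuous_intros simp: T)
    have "bounded (h u ` {0..T})"
      using h by (intro compact_imp_bounded compact_continuous_image) auto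
    then show "bounded (range (\<lambda>t. h u (max 0 (min t T))))"
      by (rule bounded_subset) (auto simp: T)
  qed
  then have A: "apply_bcontfun (A u) t = h u (max 0 (min t T))" for u t
    unfolding A_def by (simp add: Bcontfun_inverse)
  have "\<exists>!u. A u = u"
  proof (rule banach_fix_type[of "1/2"], simp, simp, intro allI)
    show "dist (A u) (A v) \<le> 1/2 * dist u v" for u v
    proof (rule dist_bound)
      fix t
      define s where "s = max 0 (min t T)"
      have s: "0 \<le> s" "s \<le> T" using T by (auto simp: s_def)
      have "\<bar>reflection_map f \<mu> (W u) s - reflection_map f \<mu> (W v) s\<bar>
          \<le> dist u v / 2 * exp (2 * \<Lambda> * s)"
      proof (rule reflection_map_contraction[OF f \<mu> \<Lambda>])
        show "\<bar>W u r - W v r\<bar> \<le> dist u v * exp (2 * \<Lambda> * r)" for r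
        proof -
          have "\<bar>W u r - W v r\<bar> \<le> \<bar>exp (2 * \<Lambda> * r) * u r - exp (2 * \<Lambda> * r) * v r\<bar>"
            unfolding W_def by linarith
          also have "\<dots> = dist (u r) (v r) * exp (2 * \<Lambda> * r)"
            by (simp add: dist_real_def abs_mult flip: right_diff_distrib)
          also have "\<dots> \<le> dist u v * exp (2 * \<Lambda> * r)"
            by (intro mult_right_mono dist_bounded) auto
          finally show ?thesis .
        qed
      qed (use W s in auto)
      then have "exp (- (2 * \<Lambda> * s)) * \<bar>reflection_map f \<mu> (W u) s - reflection_map f \<mu> (W v) s\<bar>
          \<le> exp (- (2 * \<Lambda> * s)) * (dist u v / 2 * exp (2 * \<Lambda> * s))"
        by (intro mult_left_mono) auto
      also have "\<dots> = dist u v / 2"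
        by (simp add: mult.left_commute[of "exp _"] flip: exp_add)
      finally show "dist (A u t) (A v t) \<le> 1/2 * dist u v"
        by (simp add: A s_def[symmetric] h_def dist_real_def abs_mult flip: right_diff_distrib)
    qed
  qed
  then obtain u where u: "A u = u" by auto
  have "W u t = reflection_map f \<mu> (W u) t" if t: "0 \<le> t" "t \<le> T" for t
  proof -
    have "u t = exp (- (2 * \<Lambda> * t)) * reflection_map f \<mu> (W u) t"
      using A[of u t] u t by (simp add: h_def)
    then have "exp (2 * \<Lambda> * t) * u t = reflection_map f \<mu> (W u) t"
      by (simp add: mult.assoc[symmetric] flip: exp_add)
    moreover have "0 \<le> reflection_map f \<mu> (W u) t"
      unfolding reflection_map_def
      by (rule regulator_nonneg) (use t continuous_on_subset[OF drift] in auto)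
    ultimately show ?thesis by (simp add: W_def)
  qed
  with W have "solves_up_to f \<mu> T (W u)" unfolding solves_up_to_def by blast
  then show ?thesis by blast
qed

section \<open>Absence of explosion\<close>

lemma lipschitz_of_lambda_sup:
  assumes "lambda_sup \<mu> l < \<infinity>"
  obtains \<Lambda> where "0 < \<Lambda>" "\<Lambda>-lipschitz_on {0..<l} \<mu>"
proof
  define \<Lambda> where "\<Lambda> = enn2real (lambda_sup \<mu> l) + 1"
  show "0 < \<Lambda>" by (simp add: \<Lambda>_def add_nonneg_pos)
  show "\<Lambda>-lipschitz_on {0..<l} \<mu>"
  proof (rule lipschitz_on_leI)
    fix a b assume ab: "a \<in> {0..<l}" "b \<in> {0..<l}" "a \<le> b"
    show "dist (\<mu> a) (\<mu> b) \<le> \<Lambda> * dist a b"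
    proof (cases "a = b")
      case False
      then have "ennreal (\<bar>\<mu> b - \<mu> a\<bar> / (b - a)) \<le> lambda_sup \<mu> l"
        unfolding lambda_sup_def using ab by (intro SUP_upper2[of "(a, b)"]) auto
      then have "\<bar>\<mu> b - \<mu> a\<bar> / (b - a) \<le> enn2real (lambda_sup \<mu> l)"
        using enn2real_mono[of "ennreal (\<bar>\<mu> b - \<mu> a\<bar> / (b - a))"] assms ab by auto
      then have "\<bar>\<mu> b - \<mu> a\<bar> / (b - a) \<le> \<Lambda>" by (simp add: \<Lambda>_def)
      then show ?thesis
        using ab False by (simp add: dist_real_def divide_le_eq abs_minus_commute mult.commute)
    qed simp
  qed (use \<open>0 < \<Lambda>\<close> in simp)
qed

text \<open>
  The growth hypothesis, put in the only form in which the a priori bound uses it. If \<open>- \<mu>\<close> is bounded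
  above, a constant majorant does. Otherwise \<open>\<mu>\<close>, being monotone, is nonincreasing and tends to
  \<open>-\<infinity>\<close>, so the divergent series is available and passes to \<open>max 1 (- \<mu>) \<le> max \<bar>\<mu>\<bar> 1\<close>.
\<close>

lemma nonexplosive_majorant:
  fixes \<mu> :: "real \<Rightarrow> real"
  assumes \<mu>: "continuous_on {0..} \<mu>" "mono_on {0..} \<mu> \<or> antimono_on {0..} \<mu>"
    and div: "filterlim \<mu> at_bot at_top \<longrightarrow>
           (\<Sum>n. ennreal (inverse (max \<bar>\<mu> (real (Suc n))\<bar> 1))) = \<infinity>"
  obtains \<nu> where "continuous_on {0..} \<nu>" "mono_on {0..} \<nu>"
    "\<And>l. 0 \<le> l \<Longrightarrow> 1 \<le> \<nu> l" "\<And>l. 0 \<le> l \<Longrightarrow> - \<mu> l \<le> \<nu> l"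
    "\<not> summable (\<lambda>n. inverse (\<nu> (real (Suc n))))"
proof (cases "\<exists>C. \<forall>l\<ge>0. - \<mu> l \<le> C")
  case True
  then obtain C where "\<And>l. 0 \<le> l \<Longrightarrow> - \<mu> l \<le> C" by blast
  then show ?thesis
    by (intro that[of "\<lambda>_. max 1 C"])
       (auto simp: summable_const_iff mono_on_def max.coboundedI2)
next
  case False
  have anti: "antimono_on {0..} \<mu>"
    using \<mu>(2) False by (metis atLeast_iff mono_on_def neg_le_iff_le order_refl)
  then have le: "\<mu> l' \<le> \<mu> l" if "0 \<le> l" "l \<le> l'" for l l'
    using that by (auto simp: monotone_on_def)
  have "filterlim \<mu> at_bot at_top"
    unfolding filterlim_at_bot
  proof
    fix Z
    obtain l where "0 \<le> l" "\<mu> l < Z" using False[simplified, rule_format, of "- Z"] by auto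
    then show "eventually (\<lambda>l. \<mu> l \<le> Z) at_top"
      unfolding eventually_at_top_linorder using le by (intro exI[of _ l]) fastforce
  qed
  with div have "(\<Sum>n. ennreal (inverse (max \<bar>\<mu> (real (Suc n))\<bar> 1))) = top"
    by simp
  then have ns: "\<not> summable (\<lambda>n. inverse (max \<bar>\<mu> (real (Suc n))\<bar> 1))"
    using ennreal_suminf_neq_top by force
  have "\<not> summable (\<lambda>n. inverse (max 1 (- \<mu> (real (Suc n)))))"
  proof
    assume "summable (\<lambda>n. inverse (max 1 (- \<mu> (real (Suc n)))))"
    then have "summable (\<lambda>n. inverse (max \<bar>\<mu> (real (Suc n))\<bar> 1))"
      by (rule summable_comparison_test'[where N = 0]) (auto intro!: le_imp_inverse_le)
    with ns show False ..
  qed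
  moreover have "continuous_on {0..} (\<lambda>l. max 1 (- \<mu> l))"
    by (intro continuous_intros \<mu>)
  moreover have "mono_on {0..} (\<lambda>l. max 1 (- \<mu> l))"
    using le by (intro mono_onI max.mono) auto
  ultimately show ?thesis
    by (intro that[of "\<lambda>l. max 1 (- \<mu> l)"]) auto
qed

lemma continuous_on_inverse_ge_1:
  fixes \<nu> :: "real \<Rightarrow> real"
  assumes "continuous_on {0..} \<nu>" "\<And>l. 0 \<le> l \<Longrightarrow> 1 \<le> \<nu> l" "0 \<le> a"
  shows "continuous_on {a..b} (\<lambda>l. inverse (\<nu> l))"
proof (rule continuous_on_inverse)
  show "continuous_on {a..b} \<nu>"
    using assms(3) by (intro continuous_on_subset[OF assms(1)]) auto
  show "\<forall>l\<in>{a..b}. \<nu> l \<noteq> 0"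
  proof
    show "\<nu> l \<noteq> 0" if "l \<in> {a..b}" for l using assms(2)[of l] assms(3) that by auto
  qed
qed

text \<open>
  Each term of the sum is the value at a right endpoint, where the nonincreasing function \<open>1 / \<nu>\<close> is
  least on its unit interval.
\<close>

lemma sum_le_integral_inverse:
  fixes \<nu> :: "real \<Rightarrow> real"
  assumes \<nu>: "continuous_on {0..} \<nu>" "mono_on {0..} \<nu>" "\<And>l. 0 \<le> l \<Longrightarrow> 1 \<le> \<nu> l"
  shows "(\<Sum>n<N. inverse (\<nu> (real (Suc n)))) \<le> integral {0..real N} (\<lambda>l. inverse (\<nu> l))"
proof (induction N)
  case (Suc N)
  have int: "(\<lambda>l. inverse (\<nu> l)) integrable_on {a..b}" if "0 \<le> a" for a b
    by (intro integrable_continuous_real continuous_on_inverse_ge_1 \<nu>(1,3) that)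
  have "integral {real N..real (Suc N)} (\<lambda>l. inverse (\<nu> (real (Suc N))))
      \<le> integral {real N..real (Suc N)} (\<lambda>l. inverse (\<nu> l))"
  proof (intro integral_le int)
    fix l assume "l \<in> {real N..real (Suc N)}"
    then have "0 \<le> l" "\<nu> l \<le> \<nu> (real (Suc N))"
      using \<nu>(2) by (auto simp: mono_on_def)
    then show "inverse (\<nu> (real (Suc N))) \<le> inverse (\<nu> l)"
      using \<nu>(3)[of l] by (intro le_imp_inverse_le) auto
  qed auto
  then have "inverse (\<nu> (real (Suc N))) \<le> integral {real N..real (Suc N)} (\<lambda>l. inverse (\<nu> l))"
    by simp
  moreover have "integral {0..real N} (\<lambda>l. inverse (\<nu> l))
      + integral {real N..real (Suc N)} (\<lambda>l. inverse (\<nu> l))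
      = integral {0..real (Suc N)} (\<lambda>l. inverse (\<nu> l))"
    by (intro Henstock_Kurzweil_Integration.integral_combine int) auto
  ultimately show ?case using Suc.IH by simp
qed simp

text \<open>
  Osgood's non-explosion criterion. The path \<open>y = F + \<integral> \<nu> \<circ> L\<close> dominates \<open>L\<close>, since it dominates
  \<open>- f - \<integral> \<mu> \<circ> L\<close> and increases. Hence \<open>y' = \<nu> \<circ> L \<le> \<nu> \<circ> y\<close>, and with \<open>G\<close> the primitive of \<open>1 / \<nu>\<close>
  that vanishes at \<open>0\<close>, the function \<open>G (y t) - t\<close> is nonincreasing. So \<open>G (y t) \<le> G F + T \<le> F + T < G K\<close>, where \<open>G F \<le> F\<close>
  because \<open>\<nu> \<ge> 1\<close>.
\<close>

lemma fixed_point_bound: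
  fixes f \<mu> \<nu> L :: "real \<Rightarrow> real"
  assumes \<mu>: "continuous_on {0..} \<mu>"
    and F: "0 < F" "\<And>s. 0 \<le> s \<Longrightarrow> s \<le> T \<Longrightarrow> - f s \<le> F"
    and \<nu>: "continuous_on {0..} \<nu>" "mono_on {0..} \<nu>" "\<And>l. 0 \<le> l \<Longrightarrow> 1 \<le> \<nu> l"
      "\<And>l. 0 \<le> l \<Longrightarrow> - \<mu> l \<le> \<nu> l"
    and K: "0 \<le> K" "F + T < integral {0..K} (\<lambda>l. inverse (\<nu> l))"
    and solves: "solves_up_to f \<mu> T L"
    and t: "0 \<le> t" "t \<le> T"
  shows "L t \<le> K"
proof -
  note L = solves_up_toD[OF solves]
  define y where "y = (\<lambda>t. F + integral {0..t} (\<lambda>s. \<nu> (L s)))"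
  define G where "G = (\<lambda>l. integral {0..l} (\<lambda>r. inverse (\<nu> r)))"
  have \<nu>L: "continuous_on {0..T} (\<lambda>s. \<nu> (L s))" and \<mu>L: "continuous_on {0..T} (\<lambda>s. \<mu> (L s))"
    by (rule continuous_on_compose2[OF \<nu>(1) L(1)] continuous_on_compose2[OF \<mu> L(1)],
        use L in auto)+
  have int: "(\<lambda>s. \<nu> (L s)) integrable_on {a..b}" "(\<lambda>s. \<mu> (L s)) integrable_on {a..b}"
    if "0 \<le> a" "b \<le> T" for a b
    using that by (auto intro!: integrable_continuous_real continuous_on_subset[OF \<nu>L]
        continuous_on_subset[OF \<mu>L])
  have y_mono: "y s \<le> y r" if "0 \<le> s" "s \<le> r" "r \<le> T" for r s
  proof -
    have "0 \<le> \<nu> (L q)" if "0 \<le> q" "q \<le> T" for q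
      using \<nu>(3)[of "L q"] L(2)[of q] that by simp
    then show ?thesis unfolding y_def using that
      by (intro add_left_mono integral_subset_le int) auto
  qed
  have y0: "y 0 = F" by (simp add: y_def)
  have Ly: "L s \<le> y s" if s: "0 \<le> s" "s \<le> T" for s
    unfolding L(3)[OF s] reflection_map_def
  proof (rule regulator_least)
    show "0 \<le> y s" using y_mono[of 0 s] y0 F s by simp
    show "- (f r + integral {0..r} (\<lambda>s. \<mu> (L s))) \<le> y s" if r: "0 \<le> r" "r \<le> s" for r
    proof -
      have "integral {0..r} (\<lambda>s. - \<mu> (L s)) \<le> integral {0..r} (\<lambda>s. \<nu> (L s))"
        using r s \<nu>(4) L(2) by (intro integral_le int integrable_neg) auto
      then have "- (f r + integral {0..r} (\<lambda>s. \<mu> (L s))) \<le> y r"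
        using F(2)[of r] r s by (simp add: y_def)
      then show ?thesis using y_mono[of r s] r s by simp
    qed
  qed (use s in auto)
  have inv: "continuous_on {0..b} (\<lambda>l. inverse (\<nu> l))" for b
    by (intro continuous_on_inverse_ge_1 \<nu>(1,3) order_refl)
  have G_mono: "G a \<le> G b" if "0 \<le> a" "a \<le> b" for a b
    unfolding G_def
  proof (intro integral_subset_le)
    show "\<forall>l\<in>{0..b}. 0 \<le> inverse (\<nu> l)"
    proof
      show "0 \<le> inverse (\<nu> l)" if "l \<in> {0..b}" for l using \<nu>(3)[of l] that by auto
    qed
  qed (use that inv in \<open>auto intro: integrable_continuous_real\<close>)
  have "G F \<le> integral {0..F} (\<lambda>_. 1)"
    unfolding G_def
  proof (intro integral_le)
    show "inverse (\<nu> l) \<le> 1" if "l \<in> {0..F}" for l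
      using \<nu>(3)[of l] that by (auto intro: inverse_le_1_iff[THEN iffD2])
  qed (use inv in \<open>auto intro: integrable_continuous_real\<close>)
  then have GF: "G F \<le> F" using F by simp
  have y_pos: "0 < y s" if "0 \<le> s" "s \<le> T" for s using y_mono[of 0 s] y0 F that by simp
  have y_cont: "continuous_on {0..T} y"
    unfolding y_def using int[of 0 T]
    by (intro continuous_intros indefinite_integral_continuous_1) auto
  have "G (y t) - t \<le> G (y 0) - 0"
  proof (rule DERIV_nonpos_imp_decreasing_open[of 0 t "\<lambda>s. G (y s) - s"])
    have "continuous_on {0..y T} G"
      unfolding G_def using inv by (intro indefinite_integral_continuous_1 integrable_continuous_real)
    moreover have "continuous_on {0..t} y" using y_cont t by (auto intro: continuous_on_subset)
    ultimately have "continuous_on {0..t} (\<lambda>s. G (y s))"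
      by (rule continuous_on_compose2) (use y_mono y_pos t in \<open>auto simp: less_imp_le\<close>)
    then show "continuous_on {0..t} (\<lambda>s. G (y s) - s)" by (intro continuous_intros)
    fix s assume s: "0 < s" "s < t"
    have "(y has_real_derivative \<nu> (L s)) (at s within {0..T})"
      unfolding y_def using integral_has_real_derivative[OF \<nu>L, of s] s t
      by (auto intro!: derivative_eq_intros)
    then have dy: "(y has_real_derivative \<nu> (L s)) (at s)"
      using s t at_within_Icc_at[of 0 s T] by simp
    have "(G has_real_derivative inverse (\<nu> (y s))) (at (y s) within {0..y s + 1})"
      unfolding G_def using y_pos[of s] s t by (intro integral_has_real_derivative inv) auto
    then have "(G has_real_derivative inverse (\<nu> (y s))) (at (y s))"
      using y_pos[of s] s t at_within_Icc_at[of 0 "y s" "y s + 1"] by simp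
    from DERIV_chain2[OF this dy]
    have "((\<lambda>s. G (y s) - s) has_real_derivative inverse (\<nu> (y s)) * \<nu> (L s) - 1) (at s)"
      by (auto intro!: derivative_eq_intros)
    moreover have "\<nu> (L s) \<le> \<nu> (y s)" "0 < \<nu> (y s)"
      using \<nu>(2) \<nu>(3)[of "y s"] Ly[of s] L(2)[of s] y_pos[of s] s t by (auto simp: mono_on_def)
    then have "inverse (\<nu> (y s)) * \<nu> (L s) - 1 \<le> 0" by (simp add: field_simps)
    ultimately show "\<exists>d. ((\<lambda>s. G (y s) - s) has_real_derivative d) (at s) \<and> d \<le> 0" by blast
  qed (use t in simp)
  then have "G (y t) < G K" using GF K(2) t by (simp add: y0 G_def)
  then have "y t < K" using G_mono[of K "y t"] K(1) by linarith
  then show ?thesis using Ly[OF t] by simp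
qed

section \<open>Existence and uniqueness\<close>

text \<open>
  Freezing \<open>\<mu>\<close> beyond a level \<open>N\<close> makes it globally Lipschitz. The majorant \<open>\<nu>\<close> still dominates the
  frozen coefficient, so the a priori bound, which depends on \<open>\<nu>\<close> alone, keeps the fixed point
  below \<open>N\<close> once \<open>N\<close> is large; there the frozen and the true coefficient agree.
\<close>

lemma fixed_point_on_interval:
  fixes f \<mu> :: "real \<Rightarrow> real"
  assumes f: "continuous_on {0..} f" and T: "0 \<le> T"
    and \<mu>: "continuous_on {0..} \<mu>" "mono_on {0..} \<mu> \<or> antimono_on {0..} \<mu>"
    and lip: "\<forall>l. lambda_sup \<mu> l < \<infinity>"
    and div: "filterlim \<mu> at_bot at_top \<longrightarrow>
           (\<Sum>n. ennreal (inverse (max \<bar>\<mu> (real (Suc n))\<bar> 1))) = \<infinity>"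
  shows "\<exists>L. solves_up_to f \<mu> T L"
proof -
  have fT: "continuous_on {0..T} f" using f by (auto intro: continuous_on_subset)
  then have "bounded (f ` {0..T})" by (intro compact_imp_bounded compact_continuous_image) auto
  then obtain F where F: "0 < F" "\<forall>x\<in>f ` {0..T}. norm x \<le> F" using bounded_pos by metis
  have F': "- f s \<le> F" if "0 \<le> s" "s \<le> T" for s
    using F(2) that by (auto simp: abs_le_iff)
  obtain \<nu> where \<nu>: "continuous_on {0..} \<nu>" "mono_on {0..} \<nu>"
    "\<And>l. 0 \<le> l \<Longrightarrow> 1 \<le> \<nu> l" "\<And>l. 0 \<le> l \<Longrightarrow> - \<mu> l \<le> \<nu> l"
    "\<not> summable (\<lambda>n. inverse (\<nu> (real (Suc n))))"
    using nonexplosive_majorant[OF \<mu> div] by blast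
  have "\<exists>N. F + T < (\<Sum>n<N. inverse (\<nu> (real (Suc n))))"
  proof (rule ccontr)
    assume "\<nexists>N. F + T < (\<Sum>n<N. inverse (\<nu> (real (Suc n))))"
    then have "summable (\<lambda>n. inverse (\<nu> (real (Suc n))))"
      using \<nu>(3) by (intro summableI_nonneg_bounded[of _ "F + T"])
        (auto simp: not_less intro: order_trans[OF zero_le_one])
    with \<nu>(5) show False ..
  qed
  then obtain N where "F + T < (\<Sum>n<N. inverse (\<nu> (real (Suc n))))" ..
  also have "\<dots> \<le> integral {0..real N} (\<lambda>l. inverse (\<nu> l))"
    by (rule sum_le_integral_inverse[OF \<nu>(1-3)])
  finally have K: "F + T < integral {0..real N} (\<lambda>l. inverse (\<nu> l))" .
  define m where "m = (\<lambda>l. \<mu> (min (real N) l))"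
  obtain \<Lambda> where \<Lambda>: "0 < \<Lambda>" "\<Lambda>-lipschitz_on {0..<real N + 1} \<mu>"
    using lipschitz_of_lambda_sup lip by metis
  have m: "\<Lambda>-lipschitz_on {0..} m"
  proof (rule lipschitz_onI)
    fix x y :: real assume xy: "x \<in> {0..}" "y \<in> {0..}"
    have "dist (m x) (m y) \<le> \<Lambda> * dist (min (real N) x) (min (real N) y)"
      unfolding m_def using xy by (intro lipschitz_onD[OF \<Lambda>(2)]) auto
    also have "\<dots> \<le> \<Lambda> * dist x y"
      using \<Lambda>(1) by (intro mult_left_mono) (auto simp: dist_real_def)
    finally show "dist (m x) (m y) \<le> \<Lambda> * dist x y" .
  qed (use \<Lambda> in simp)
  obtain L where solves: "solves_up_to f m T L"
    using reflection_map_fixed_point_exists[OF fT T m \<Lambda>(1)] ..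
  note L = solves_up_toD[OF solves]
  have m\<nu>: "- m l \<le> \<nu> l" if "0 \<le> l" for l
  proof -
    have "\<nu> (min (real N) l) \<le> \<nu> l" using \<nu>(2) that by (auto simp: mono_on_def)
    then show ?thesis using \<nu>(4)[of "min (real N) l"] that by (simp add: m_def)
  qed
  have bound: "L t \<le> real N" if "0 \<le> t" "t \<le> T" for t
    by (rule fixed_point_bound[OF lipschitz_on_continuous_on[OF m] F(1) F' \<nu>(1-3) m\<nu>
          of_nat_0_le_iff K solves that])
  have "L t = reflection_map f \<mu> L t" if t: "0 \<le> t" "t \<le> T" for t
    by (rule trans[OF L(3)[OF t] reflection_map_cong]) (use bound t in \<open>simp add: m_def\<close>)
  with L(1,2) show ?thesis unfolding solves_up_to_def by blast
qed

lemma fixed_point_unique: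
  assumes f: "continuous_on {0..} f" and lip: "\<forall>l. lambda_sup \<mu> l < \<infinity>"
    and L: "solves_up_to f \<mu> T L" and M: "solves_up_to f \<mu> T M"
    and t: "0 \<le> t" "t \<le> T"
  shows "L t = M t"
proof -
  note LD = solves_up_toD[OF L] and MD = solves_up_toD[OF M]
  have "bounded (L ` {0..T} \<union> M ` {0..T})"
    using LD(1) MD(1) by (auto intro!: compact_imp_bounded compact_continuous_image)
  then obtain K where K: "\<forall>x\<in>L ` {0..T} \<union> M ` {0..T}. norm x \<le> K" using bounded_pos by metis
  obtain \<Lambda> where \<Lambda>: "0 < \<Lambda>" "\<Lambda>-lipschitz_on {0..<K + 1} \<mu>"
    using lipschitz_of_lambda_sup lip by metis
  have range: "L s \<in> {0..<K + 1}" "M s \<in> {0..<K + 1}" if "0 \<le> s" "s \<le> T" for s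
    using that K LD(2)[of s] MD(2)[of s] by (force simp: abs_le_iff)+
  have "continuous_on {0..T} f" using f by (auto intro: continuous_on_subset)
  from reflection_map_fixed_point_unique[OF this \<Lambda>(2,1) L M range t] show ?thesis .
qed

theorem theorem2p1:
  fixes f \<mu> :: "real \<Rightarrow> real"
  assumes "continuous_on {0..} f" and "f 0 \<ge> 0"
    and "continuous_on {0..} \<mu>"
    and "mono_on {0..} \<mu> \<or> antimono_on {0..} \<mu>"
    and "\<forall>l. lambda_sup \<mu> l < \<infinity>"
    and "filterlim \<mu> at_bot at_top \<longrightarrow>
           (\<Sum>n. ennreal (inverse (max \<bar>\<mu> (real (Suc n))\<bar> 1))) = \<infinity>"
  shows "\<exists>L. reflection_solution f \<mu> L \<and>
           (\<forall>L'. reflection_solution f \<mu> L' \<longrightarrow> (\<forall>t\<ge>0. L' t = L t))"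
proof -
  define X where "X T = (SOME L. solves_up_to f \<mu> T L)" for T
  have X: "solves_up_to f \<mu> T (X T)" if "0 \<le> T" for T
    unfolding X_def by (rule someI_ex[OF fixed_point_on_interval[OF assms(1) that assms(3-6)]])
  \<comment> \<open>Uniqueness makes the solutions on the intervals \<open>[0, T]\<close> extend one another.\<close>
  define L where "L t = X t t" for t
  have LX: "L t = X T t" if t: "0 \<le> t" "t \<le> T" for t T
    unfolding L_def
    by (rule fixed_point_unique[OF assms(1,5) X solves_up_to_mono[OF X]]) (use t in auto)
  have L: "solves_up_to f \<mu> T L" if "0 \<le> T" for T
    using X[OF that] by (rule solves_up_to_cong) (simp add: LX)
  have Lc: "continuous_on {0..} L"
    by (rule continuous_on_half_lineI) (rule solves_up_toD(1)[OF L])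
  show ?thesis
  proof (intro exI conjI allI impI)
    show "reflection_solution f \<mu> L"
      by (rule fixed_point_imp_reflection_solution[OF assms(1-3) Lc])
         (rule solves_up_toD(2,3)[OF L _ order_refl]; assumption)+
    fix L' t assume L': "reflection_solution f \<mu> L'" and t: "0 \<le> (t::real)"
    note fp = reflection_solution_imp_fixed_point[OF assms(1,3) L']
    have "solves_up_to f \<mu> t L'"
      unfolding solves_up_to_def
    proof (intro conjI allI impI)
      show "continuous_on {0..t} L'" by (rule continuous_on_subset[OF fp(1)]) auto
    qed (rule fp(2,3); assumption)+
    then show "L' t = L t"
      by (rule fixed_point_unique[OF assms(1,5) _ L[OF t] t order_refl])
  qed
qed

end
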